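(* Let $D\subset\mathbb{Z}$ be an infinite set of traps. The criticality of the model is independent of whether $0$ is a trap: the model with trap set $D\cup\{0\}$ is critical if and only if the model with trap set $D\setminus\{0\}$ is critical. More generally, adding or removing finitely many traps does not affect criticality: if $D'\subset\mathbb{Z}$ is such that the symmetric difference of $D$ and $D'$ is finite, then the model with trap set $D$ is critical if and only if the model with trap set $D'$ is critical.
   Context: Given a trap set $D\subset\mathbb{Z}$, define $\deg(x)=2+\mathbf 1_{x\in D}$ for $x\in\mathbb{Z}$ and the Laplacian matrix $\Delta$ by $\Delta_{x,x}=\deg(x)$, $\Delta_{x,y}=-1$ if $|x-y|=1$, and $\Delta_{x,y}=0$ otherwise. For $n\in\mathbb{N}$ let $\Delta_n$ be the restriction of the matrix $\Delta$ to rows and columns indexed by $\{-n,\dots,n\}$, and let $G_n(x,y)=(\Delta_n^{-1})(x,y)$ (extended by $0$ when $x$ or $y$ is outside $\{-n,\dots,n\}$). $G_n(x,y)$ is nondecreasing in $n$; put $G(x,y)=\lim_{n\to\infty}G_n(x,y)\in[0,\infty]$. The model with trap set $D$ is called non-critical if for all $x\in\mathbb{Z}$, $\sum_{y\in\mathbb{Z}}G(x,y)<\infty$; otherwise it is called critical. Equivalently, the model is critical if and only if $\mathbb{E}_x(T)=\infty$ for some (equivalently every) $x\in\mathbb{Z}$, where $T$ is the hitting time of the absorbing sink $s$ by the Markov chain on $\mathbb{Z}\cup\{s\}$ which moves from $x\notin D$ to $x\pm1$ with probability $1/2$ each and from $x\in D$ to $x-1$, $x+1$ or $s$ with probability $1/3$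 each, and $\mathbb{E}_x$ is expectation for the chain started at $x$. *)

theory Defs
  imports
    "HOL-Analysis.Analysis"
    "Jordan_Normal_Form.Gauss_Jordan_Elimination"
begin

definition trap_deg :: "int set \<Rightarrow> int \<Rightarrow> real" where
  "trap_deg D x = 2 + of_bool (x \<in> D)"

definition laplacian :: "int set \<Rightarrow> int \<Rightarrow> int \<Rightarrow> real" where
  "laplacian D x y =
     (if x = y then trap_deg D x else if \<bar>x - y\<bar> = 1 then - 1 else 0)"

(* Row and column i of the matrix, 0 \<le> i \<le> 2 * n, stand for the site i - n of {-n..n}. *)
definition laplacian_mat :: "int set \<Rightarrow> nat \<Rightarrow> real mat" where
  "laplacian_mat D n =
     mat (2 * n + 1) (2 * n + 1) (\<lambda>(i, j). laplacian D (int i - int n) (int j - int n))"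

(* mat_inverse returns Some precisely on invertible matrices; laplacian_mat D n is always
   positive definite, so the value of "the" on None plays no role. *)
definition green_n :: "int set \<Rightarrow> nat \<Rightarrow> int \<Rightarrow> int \<Rightarrow> real" where
  "green_n D n x y =
     (if x \<in> {- int n..int n} \<and> y \<in> {- int n..int n}
      then the (mat_inverse (laplacian_mat D n)) $$ (nat (x + int n), nat (y + int n))
      else 0)"

(* The entries green_n D n x y are nonnegative, so ennreal truncates nothing, and they are
   nondecreasing in n, so the limit exists in [0, \<infinity>]. *)
definition green :: "int set \<Rightarrow> int \<Rightarrow> int \<Rightarrow> ennreal" where
  "green D x y = lim (\<lambda>n. ennreal (green_n D n x y))"

definition non_critical :: "int set \<Rightarrow> bool" where
  "non_critical D \<longleftrightarrow> (\<forall>x. (\<Sum>\<^sub>\<infinity>y\<in>UNIV. green D x y) < \<infinity>)"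

definition critical :: "int set \<Rightarrow> bool" where
  "critical D \<longleftrightarrow> \<not> non_critical D"

end

theory Submission
  imports Defs "Jordan_Normal_Form.Determinant"
begin

text \<open>
  The model is non-critical iff there is a nonnegative function \<open>u\<close> on the integers with
  \<open>\<Delta> u \<ge> 1\<close>: such a \<open>u\<close> dominates all row sums of \<open>G\<^sub>n\<close> by the minimum principle, and conversely
  finite row sums of \<open>G\<close> satisfy \<open>\<Delta> u = 1\<close>. Adding a trap can only increase \<open>\<Delta> u\<close>. Removing the
  trap \<open>z\<close> decreases it by \<open>u z\<close> at \<open>z\<close> only, which is repaired by adding \<open>u z\<close> times a bounded
  positive function \<open>h\<close> with \<open>\<Delta> h \<ge> 1\<^sub>z\<close>; a single remaining trap \<open>w\<close> is enough to construct \<open>h\<close>.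
\<close>

section \<open>The Laplacian as an operator on functions, and its minimum principle\<close>

definition lap :: "int set \<Rightarrow> (int \<Rightarrow> real) \<Rightarrow> int \<Rightarrow> real" where
  "lap D f x = trap_deg D x * f x - f (x - 1) - f (x + 1)"

definition has_supersolution :: "int set \<Rightarrow> bool" where
  "has_supersolution D \<longleftrightarrow> (\<exists>u. (\<forall>x. 0 \<le> u x) \<and> (\<forall>x. 1 \<le> lap D u x))"

lemma lap_add: "lap D (\<lambda>x. f x + g x) x = lap D f x + lap D g x"
  by (simp add: lap_def algebra_simps)

lemma lap_diff: "lap D (\<lambda>x. f x - g x) x = lap D f x - lap D g x"
  by (simp add: lap_def algebra_simps)

lemma lap_uminus: "lap D (\<lambda>x. - f x) x = - lap D f x"
  by (simp add: lap_def algebra_simps)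

lemma lap_cmult: "lap D (\<lambda>x. c * f x) x = c * lap D f x"
  by (simp add: lap_def algebra_simps)

lemma lap_sum: "lap D (\<lambda>x. \<Sum>y\<in>A. f y x) x = (\<Sum>y\<in>A. lap D (f y) x)"
  by (simp add: lap_def sum_subtractf sum_distrib_left)

lemma lap_change_traps:
  "lap D' f x = lap D f x + (of_bool (x \<in> D') - of_bool (x \<in> D)) * f x"
  by (simp add: lap_def trap_deg_def algebra_simps)

text \<open>A negative value forces a negative global minimum \<open>m\<close> inside the finite
  interval. There the trap term only helps, since \<open>trap_deg D z * m \<le> 2 * m\<close>, and
  both neighbours are at least \<open>m\<close>, so one strict inequality makes the Laplacian
  negative. All later comparisons reduce to this.\<close>

lemma lap_minimum_principle:
  fixes f :: "int \<Rightarrow> real"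
  assumes out: "\<And>x. x \<notin> {a..b} \<Longrightarrow> 0 \<le> f x"
    and super: "\<And>x. x \<in> {a..b} \<Longrightarrow> 0 \<le> lap D f x"
  shows "0 \<le> f x"
proof (rule ccontr)
  assume "\<not> 0 \<le> f x"
  then have neg: "f x < 0" by simp
  with out have x: "x \<in> {a..b}" by force
  define m where "m = Min (f ` {a..b})"
  define S where "S = {y \<in> {a..b}. f y = m}"
  have m_le: "m \<le> f y" if "y \<in> {a..b}" for y
    using that by (simp add: m_def)
  have m_neg: "m < 0" using m_le[OF x] neg by simp
  have m_le': "m \<le> f y" for y
    using m_le out m_neg by (cases "y \<in> {a..b}") force+
  have "m \<in> f ` {a..b}" unfolding m_def using x by (intro Min_in) auto
  then have "S \<noteq> {}" by (auto simp: S_def)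
  moreover have "finite S" unfolding S_def by (rule finite_subset[of _ "{a..b}"]) auto
  ultimately have S: "finite S" "S \<noteq> {}" by simp_all
  \<comment> \<open>The leftmost minimum point has a strictly larger left neighbour.\<close>
  define z where "z = Min S"
  have z: "z \<in> {a..b}" "f z = m" using Min_in[OF S] by (auto simp: z_def S_def)
  have "z - 1 \<notin> S" using Min_le[OF S(1), of "z - 1"] by (auto simp: z_def)
  then have "m \<noteq> f (z - 1)"
    using out[of "z - 1"] m_neg by (auto simp: S_def)
  then have "m < f (z - 1)" using m_le'[of "z - 1"] by simp
  moreover have "m \<le> f (z + 1)" by (rule m_le')
  moreover have "trap_deg D z * m \<le> 2 * m"
    using m_neg by (simp add: trap_deg_def algebra_simps)
  ultimately have "lap D f z < 0" using z(2) by (simp add: lap_def)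
  with super[OF z(1)] show False by simp
qed

section \<open>The finite Laplacian matrix and its invertibility\<close>

lemma sum_laplacian:
  assumes x: "x \<in> {- int n..int n}"
    and out: "\<And>y. y \<notin> {- int n..int n} \<Longrightarrow> f y = 0"
  shows "(\<Sum>j<2 * n + 1. laplacian D x (int j - int n) * f (int j - int n)) = lap D f x"
proof -
  have "(\<Sum>j<2 * n + 1. laplacian D x (int j - int n) * f (int j - int n))
      = (\<Sum>y\<in>{- int n..int n}. laplacian D x y * f y)"
    by (rule sum.reindex_bij_witness[where i = "\<lambda>y. nat (y + int n)" and j = "\<lambda>j. int j - int n"])
      auto
  \<comment> \<open>The interval is widened by one on each side, where \<open>f\<close> vanishes, so
    that \<open>x - 1\<close> and \<open>x + 1\<close> lie in it even when \<open>x\<close> is an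
    endpoint.\<close>
  also have "\<dots> = (\<Sum>y\<in>{- int n - 1..int n + 1}. laplacian D x y * f y)"
    by (rule sum.mono_neutral_left) (auto simp: out)
  also have "\<dots> = (\<Sum>y\<in>{x - 1, x, x + 1}. laplacian D x y * f y)"
    by (rule sum.mono_neutral_right) (use x in \<open>auto simp: laplacian_def\<close>)
  also have "\<dots> = lap D f x"
    by (simp add: laplacian_def lap_def)
  finally show ?thesis .
qed

lemma laplacian_mat_carrier: "laplacian_mat D n \<in> carrier_mat (2 * n + 1) (2 * n + 1)"
  by (simp add: laplacian_mat_def)

lemma laplacian_mat_index:
  assumes "x \<in> {- int n..int n}" "j < 2 * n + 1"
  shows "laplacian_mat D n $$ (nat (x + int n), j) = laplacian D x (int j - int n)"
proof -
  have "nat (x + int n) < 2 * n + 1" using assms(1) by auto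
  then show ?thesis using assms by (simp add: laplacian_mat_def)
qed

text \<open>A kernel vector, extended by zero, has zero Laplacian inside the box and vanishes
  outside; the minimum principle for it and its negative makes it zero.\<close>

lemma det_laplacian_mat: "det (laplacian_mat D n) \<noteq> 0"
proof
  let ?N = "2 * n + 1"
  assume "det (laplacian_mat D n) = 0"
  then obtain v where v: "v \<in> carrier_vec ?N" "v \<noteq> 0\<^sub>v ?N"
    and Av: "laplacian_mat D n *\<^sub>v v = 0\<^sub>v ?N"
    using det_0_iff_vec_prod_zero[OF laplacian_mat_carrier] by blast
  define f where
    "f x = (if x \<in> {- int n..int n} then vec_index v (nat (x + int n)) else 0)" for x
  have f_out: "f x = 0" if "x \<notin> {- int n..int n}" for x
    using that by (simp only: f_def if_False)
  have lap: "lap D f x = 0" if x: "x \<in> {- int n..int n}" for x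
  proof -
    have i: "nat (x + int n) < ?N" using x by auto
    have fj: "f (int j - int n) = vec_index v j" if "j < ?N" for j
      using that by (auto simp: f_def)
    have "0 = vec_index (laplacian_mat D n *\<^sub>v v) (nat (x + int n))"
      using Av i by simp
    also have "\<dots> = (\<Sum>j<?N. laplacian_mat D n $$ (nat (x + int n), j) * vec_index v j)"
      using i v(1) laplacian_mat_carrier[of D n]
      by (simp add: scalar_prod_def atLeast0LessThan)
    also have "\<dots> = (\<Sum>j<?N. laplacian D x (int j - int n) * f (int j - int n))"
      by (rule sum.cong) (simp_all only: laplacian_mat_index[OF x] fj lessThan_iff)
    also have "\<dots> = lap D f x" by (rule sum_laplacian[OF x f_out])
    finally show ?thesis by simp
  qed
  have "f x = 0" for x
  proof (rule antisym)
    show "0 \<le> f x"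
      by (rule lap_minimum_principle[of "- int n" "int n" f D]) (simp_all add: f_out lap del: atLeastAtMost_iff)
    have "0 \<le> - f x"
      by (rule lap_minimum_principle[of "- int n" "int n" "\<lambda>x. - f x" D])
        (simp_all add: f_out lap lap_uminus del: atLeastAtMost_iff)
    then show "f x \<le> 0" by simp
  qed
  then have "vec_index v j = 0" if "j < ?N" for j
    using that f_def[of "int j - int n"] by (auto split: if_splits)
  then have "v = 0\<^sub>v ?N" using v(1) by (intro eq_vecI) auto
  with v(2) show False by simp
qed

text \<open>This ensures that \<open>the\<close> in \<open>green_n\<close> extracts a genuine
  inverse.\<close>

lemma mat_inverse_laplacian_mat:
  obtains B where "mat_inverse (laplacian_mat D n) = Some B"
    "laplacian_mat D n * B = 1\<^sub>m (2 * n + 1)" "B \<in> carrier_mat (2 * n + 1) (2 * n + 1)"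
proof (cases "mat_inverse (laplacian_mat D n)")
  case None
  have "laplacian_mat D n \<in> Units (ring_mat TYPE(real) (2 * n + 1) ())"
    by (rule det_non_zero_imp_unit[OF laplacian_mat_carrier det_laplacian_mat])
  with mat_inverse(1)[OF laplacian_mat_carrier None] show ?thesis by (rule notE)
next
  case (Some B)
  then show ?thesis using mat_inverse(2)[OF laplacian_mat_carrier Some] that by blast
qed

section \<open>Finite-volume Green functions and their limit\<close>

lemma green_n_outside:
  assumes "x \<notin> {- int n..int n} \<or> y \<notin> {- int n..int n}"
  shows "green_n D n x y = 0"
  unfolding green_n_def using assms by (meson)

lemma lap_green_n:
  assumes x: "x \<in> {- int n..int n}" and y: "y \<in> {- int n..int n}"
  shows "lap D (\<lambda>x. green_n D n x y) x = of_bool (x = y)"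
proof -
  let ?N = "2 * n + 1"
  obtain B where B: "mat_inverse (laplacian_mat D n) = Some B"
    "laplacian_mat D n * B = 1\<^sub>m ?N" "B \<in> carrier_mat ?N ?N"
    by (rule mat_inverse_laplacian_mat)
  have i: "nat (x + int n) < ?N" "nat (y + int n) < ?N" using x y by auto
  have gj: "green_n D n (int j - int n) y = B $$ (j, nat (y + int n))" if "j < ?N" for j
    using that y B(1) by (auto simp: green_n_def)
  have "lap D (\<lambda>x. green_n D n x y) x
      = (\<Sum>j<?N. laplacian D x (int j - int n) * green_n D n (int j - int n) y)"
    by (rule sum_laplacian[OF x, symmetric]) (rule green_n_outside, blast)
  also have "\<dots> = (\<Sum>j<?N. laplacian_mat D n $$ (nat (x + int n), j) * B $$ (j, nat (y + int n)))"
    by (rule sum.cong) (simp_all only: laplacian_mat_index[OF x] gj lessThan_iff)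
  also have "\<dots> = (laplacian_mat D n * B) $$ (nat (x + int n), nat (y + int n))"
    using i B(3) laplacian_mat_carrier[of D n]
    by (simp add: scalar_prod_def atLeast0LessThan)
  also have "\<dots> = of_bool (x = y)" using i x y B(2) by auto
  finally show ?thesis .
qed

lemma green_n_nonneg: "0 \<le> green_n D n x y"
proof (cases "y \<in> {- int n..int n}")
  case True
  show ?thesis
    by (rule lap_minimum_principle[of "- int n" "int n" "\<lambda>x. green_n D n x y" D])
      (simp_all add: green_n_outside lap_green_n[OF _ True] del: atLeastAtMost_iff)
qed (simp add: green_n_outside)

text \<open>For \<open>y\<close> in the small box, the difference of the two columns has zero
  Laplacian there, because the indicators cancel; outside, it equals the nonnegative larger Green
  function.\<close>

lemma green_n_mono:
  assumes "n \<le> m"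
  shows "green_n D n x y \<le> green_n D m x y"
proof (cases "y \<in> {- int n..int n}")
  case True
  have sub: "z \<in> {- int n..int n} \<Longrightarrow> z \<in> {- int m..int m}" for z using assms by auto
  have "0 \<le> green_n D m x y - green_n D n x y"
    by (rule lap_minimum_principle[of "- int n" "int n" _ D])
      (simp_all add: green_n_outside green_n_nonneg lap_diff lap_green_n[OF _ True]
        lap_green_n[OF sub sub[OF True]] del: atLeastAtMost_iff)
  then show ?thesis by simp
qed (simp add: green_n_outside green_n_nonneg del: atLeastAtMost_iff)

text \<open>Monotonicity in \<open>n\<close> makes the \<open>lim\<close> in \<open>green\<close> a
  true limit, namely the supremum.\<close>

lemma green_n_tendsto_green: "(\<lambda>n. ennreal (green_n D n x y)) \<longlonglongrightarrow> green D x y"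
proof -
  have "incseq (\<lambda>n. ennreal (green_n D n x y))"
    by (intro incseq_SucI ennreal_leI green_n_mono) simp
  then have "convergent (\<lambda>n. ennreal (green_n D n x y))"
    using LIMSEQ_SUP convergent_def by blast
  then show ?thesis by (simp add: green_def convergent_LIMSEQ_iff)
qed

lemma green_n_le_green: "ennreal (green_n D n x y) \<le> green D x y"
proof (rule LIMSEQ_le_const[OF green_n_tendsto_green])
  show "\<exists>N. \<forall>m\<ge>N. ennreal (green_n D n x y) \<le> ennreal (green_n D m x y)"
    by (intro exI[of _ n] allI impI ennreal_leI green_n_mono)
qed

section \<open>Row sums, and non-criticality in terms of supersolutions\<close>

definition green_row_sum :: "int set \<Rightarrow> nat \<Rightarrow> int \<Rightarrow> real" where
  "green_row_sum D n x = (\<Sum>y\<in>{- int n..int n}. green_n D n x y)"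

lemma green_row_sum_nonneg: "0 \<le> green_row_sum D n x"
  unfolding green_row_sum_def by (intro sum_nonneg green_n_nonneg)

lemma green_row_sum_outside: "x \<notin> {- int n..int n} \<Longrightarrow> green_row_sum D n x = 0"
  unfolding green_row_sum_def by (intro sum.neutral ballI green_n_outside) blast

text \<open>Summing the indicators produced by the columns gives 1, so the row sums solve
  \<open>\<Delta> u = 1\<close> on the box with zero values outside.\<close>

lemma lap_green_row_sum:
  assumes "x \<in> {- int n..int n}"
  shows "lap D (green_row_sum D n) x = 1"
proof -
  have "lap D (green_row_sum D n) x = (\<Sum>y\<in>{- int n..int n}. lap D (\<lambda>x. green_n D n x y) x)"
    unfolding green_row_sum_def[abs_def] by (rule lap_sum)
  also have "\<dots> = (\<Sum>y\<in>{- int n..int n}. of_bool (x = y))"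
    by (intro sum.cong refl lap_green_n assms)
  also have "\<dots> = 1" using assms by (simp add: of_bool_def)
  finally show ?thesis .
qed

lemma green_row_sum_mono:
  assumes "n \<le> m"
  shows "green_row_sum D n x \<le> green_row_sum D m x"
proof -
  have "green_row_sum D n x \<le> (\<Sum>y\<in>{- int n..int n}. green_n D m x y)"
    unfolding green_row_sum_def by (intro sum_mono green_n_mono assms)
  also have "\<dots> \<le> green_row_sum D m x"
    unfolding green_row_sum_def using assms by (intro sum_mono2 green_n_nonneg) auto
  finally show ?thesis .
qed

lemma infsum_ennreal_eq_SUP:
  fixes f :: "'a \<Rightarrow> ennreal"
  shows "infsum f UNIV = (SUP F\<in>{F. finite F}. sum f F)"
  by (subst nonneg_infsum_complete) simp_all

lemma has_supersolution_imp_non_critical: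
  assumes "has_supersolution D"
  shows "non_critical D"
  unfolding non_critical_def
proof
  fix x
  obtain u where u: "\<And>x. 0 \<le> u x" "\<And>x. 1 \<le> lap D u x"
    using assms by (auto simp: has_supersolution_def)
  have row: "green_row_sum D n x \<le> u x" for n
  proof -
    have "0 \<le> u x - green_row_sum D n x"
      by (rule lap_minimum_principle[of "- int n" "int n" _ D])
        (simp_all add: green_row_sum_outside u lap_diff lap_green_row_sum del: atLeastAtMost_iff)
    then show ?thesis by simp
  qed
  \<comment> \<open>Finite \<open>F\<close> lets the limit in \<open>n\<close> pass through the sum;
    the infinite sum is then the supremum over such \<open>F\<close>.\<close>
  have fin: "(\<Sum>y\<in>F. green D x y) \<le> ennreal (u x)" if "finite F" for F
  proof (rule LIMSEQ_le_const2)
    show "(\<lambda>n. \<Sum>y\<in>F. ennreal (green_n D n x y)) \<longlonglongrightarrow> (\<Sum>y\<in>F. green D x y)"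
      by (intro tendsto_sum green_n_tendsto_green)
    have "(\<Sum>y\<in>F. ennreal (green_n D n x y)) \<le> ennreal (u x)" for n
    proof -
      have "(\<Sum>y\<in>F. green_n D n x y) = (\<Sum>y\<in>F \<inter> {- int n..int n}. green_n D n x y)"
        using that by (intro sum.mono_neutral_right ballI green_n_outside) auto
      also have "\<dots> \<le> green_row_sum D n x"
        unfolding green_row_sum_def by (intro sum_mono2 green_n_nonneg) auto
      also have "\<dots> \<le> u x" by (rule row)
      finally show ?thesis by (simp add: sum_ennreal green_n_nonneg ennreal_leI)
    qed
    then show "\<exists>N. \<forall>n\<ge>N. (\<Sum>y\<in>F. ennreal (green_n D n x y)) \<le> ennreal (u x)" by blast
  qed
  have "(\<Sum>\<^sub>\<infinity>y\<in>UNIV. green D x y) \<le> ennreal (u x)"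
    unfolding infsum_ennreal_eq_SUP by (intro SUP_least fin) simp
  then show "(\<Sum>\<^sub>\<infinity>y\<in>UNIV. green D x y) < \<infinity>"
    by (simp add: order_le_less_trans)
qed

text \<open>The witness is the increasing limit of the row sums. The operator involves only three
  sites, so the equation passes to the limit.\<close>

lemma non_critical_imp_has_supersolution:
  assumes "non_critical D"
  shows "has_supersolution D"
proof -
  have bound: "green_row_sum D n x \<le> enn2real (\<Sum>\<^sub>\<infinity>y\<in>UNIV. green D x y)" for n x
  proof -
    have fin: "(\<Sum>\<^sub>\<infinity>y\<in>UNIV. green D x y) < \<infinity>"
      using assms by (auto simp: non_critical_def)
    have "ennreal (green_row_sum D n x) = (\<Sum>y\<in>{- int n..int n}. ennreal (green_n D n x y))"
      by (simp add: green_row_sum_def sum_ennreal green_n_nonneg)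
    also have "\<dots> \<le> (\<Sum>y\<in>{- int n..int n}. green D x y)"
      by (intro sum_mono green_n_le_green)
    also have "\<dots> \<le> (\<Sum>\<^sub>\<infinity>y\<in>UNIV. green D x y)"
      unfolding infsum_ennreal_eq_SUP
      by (rule SUP_upper[where f = "sum (green D x)"]) simp
    \<comment> \<open>Non-criticality enters here: \<open>enn2real\<close> sends infinity to 0, so
      it preserves the inequality only because the right-hand sum is finite.\<close>
    finally have "enn2real (ennreal (green_row_sum D n x)) \<le> enn2real (\<Sum>\<^sub>\<infinity>y\<in>UNIV. green D x y)"
      using fin by (intro enn2real_mono) simp_all
    then show ?thesis by (simp add: green_row_sum_nonneg)
  qed
  have "\<exists>L. (\<lambda>n. green_row_sum D n x) \<longlonglongrightarrow> L" for x
    by (rule incseq_convergent[of "\<lambda>n. green_row_sum D n x" "enn2real (\<Sum>\<^sub>\<infinity>y\<in>UNIV. green D x y)"])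
      (auto intro!: incseq_SucI green_row_sum_mono bound)
  then obtain u where u: "\<And>x. (\<lambda>n. green_row_sum D n x) \<longlonglongrightarrow> u x" by metis
  have "0 \<le> u x" for x
    by (rule LIMSEQ_le_const[OF u]) (simp add: green_row_sum_nonneg)
  moreover have "lap D u x = 1" for x
  proof (rule LIMSEQ_unique)
    show "(\<lambda>n. lap D (green_row_sum D n) x) \<longlonglongrightarrow> lap D u x"
      unfolding lap_def by (intro tendsto_intros u)
    have "\<forall>\<^sub>F n in sequentially. lap D (green_row_sum D n) x = 1"
      \<comment> \<open>From this index on, \<open>x\<close> lies in the box.\<close>
      using eventually_ge_at_top[of "nat \<bar>x\<bar>"]
      by eventually_elim (rule lap_green_row_sum, auto)
    then show "(\<lambda>n. lap D (green_row_sum D n) x) \<longlonglongrightarrow> 1" by (rule tendsto_eventually)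
  qed
  ultimately show ?thesis
    unfolding has_supersolution_def by (intro exI[of _ u]) auto
qed

section \<open>Changing the trap set\<close>

lemma ex_positive_lap_ge_indicator:
  assumes "w \<in> D"
  obtains h :: "int \<Rightarrow> real"
  where "\<And>x. 0 \<le> h x" "\<And>x. of_bool (x = z) \<le> lap D h x"
proof
  \<comment> \<open>\<open>\<Delta>\<close> without traps maps \<open>\<bar>x - z\<bar>\<close> to \<open>- 2 * 1\<^sub>z\<close>, and \<open>h w = 2\<close> compensates the kink at \<open>w\<close>.\<close>
  define h where "h x = real_of_int (\<bar>w - z\<bar> + 2 + \<bar>x - w\<bar> - \<bar>x - z\<bar>)" for x
  \<comment> \<open>By the triangle inequality \<open>h\<close> is even at least 2, with equality at
    \<open>w\<close>.\<close>
  show nonneg: "0 \<le> h x" for x by (simp add: h_def)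
  show "of_bool (x = z) \<le> lap D h x" for x
  proof -
    have free: "2 * h x - h (x - 1) - h (x + 1) = 2 * of_bool (x = z) - 2 * of_bool (x = w)"
      unfolding h_def by (auto simp: abs_if)
    have "lap D h x = 2 * of_bool (x = z) - 2 * of_bool (x = w) + of_bool (x \<in> D) * h x"
      using free by (simp add: lap_def trap_deg_def algebra_simps)
    moreover have "h w = 2" by (simp add: h_def)
    \<comment> \<open>At \<open>w\<close> the trap term is exactly 2 and cancels the negative term,
      also when \<open>z = w\<close>; elsewhere it is nonnegative.\<close>
    ultimately show ?thesis using nonneg[of x] assms by (cases "x = w") auto
  qed
qed

lemma has_supersolution_change_traps:
  assumes "finite (D - D')" "D' \<noteq> {}" "has_supersolution D"
  shows "has_supersolution D'"
proof -
  obtain u where u: "\<And>x. 0 \<le> u x" "\<And>x. 1 \<le> lap D u x"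
    using assms(3) by (auto simp: has_supersolution_def)
  obtain w where w: "w \<in> D'" using assms(2) by blast
  have "\<forall>z. \<exists>h :: int \<Rightarrow> real. (\<forall>x. 0 \<le> h x) \<and> (\<forall>x. of_bool (x = z) \<le> lap D' h x)"
    using ex_positive_lap_ge_indicator[OF w] by metis
  then obtain h :: "int \<Rightarrow> int \<Rightarrow> real"
    where h: "\<And>z x. 0 \<le> h z x" "\<And>z x. of_bool (x = z) \<le> lap D' (h z) x" by metis
  \<comment> \<open>All removed traps are repaired at once: the summand for \<open>z\<close>
    restores the loss \<open>u z\<close> at \<open>z\<close> and lowers the Laplacian
    nowhere.\<close>
  define v where "v x = u x + (\<Sum>z\<in>D - D'. u z * h z x)" for x
  have "0 \<le> v x" for x
    unfolding v_def by (intro add_nonneg_nonneg sum_nonneg mult_nonneg_nonneg u h)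
  moreover have "1 \<le> lap D' v x" for x
  proof -
    have "of_bool (x \<in> D - D') * u x = (\<Sum>z\<in>D - D'. u z * of_bool (x = z))"
      using assms(1) by (simp add: of_bool_def if_distrib cong: if_cong)
    also have "\<dots> \<le> (\<Sum>z\<in>D - D'. u z * lap D' (h z) x)"
      by (intro sum_mono mult_left_mono u h)
    finally have "of_bool (x \<in> D - D') * u x \<le> (\<Sum>z\<in>D - D'. u z * lap D' (h z) x)" .
    moreover have "lap D' v x = lap D' u x + (\<Sum>z\<in>D - D'. u z * lap D' (h z) x)"
      unfolding v_def[abs_def] by (simp add: lap_add lap_sum lap_cmult)
    \<comment> \<open>A removed trap at \<open>x\<close> costs \<open>u x\<close>; an added one
      contributes \<open>u x \<ge> 0\<close>.\<close>
    moreover have "1 - of_bool (x \<in> D - D') * u x \<le> lap D' u x"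
      using u[of x] by (auto simp: lap_change_traps[of D' u x D])
    ultimately show ?thesis by linarith
  qed
  ultimately show ?thesis unfolding has_supersolution_def by blast
qed

lemma non_critical_iff_has_supersolution: "non_critical D \<longleftrightarrow> has_supersolution D"
  using has_supersolution_imp_non_critical non_critical_imp_has_supersolution by blast

lemma critical_cong_finite_sym_diff:
  assumes "finite (sym_diff D D')" "D \<noteq> {}" "D' \<noteq> {}"
  shows "critical D \<longleftrightarrow> critical D'"
proof -
  have "finite (D - D')" "finite (D' - D)" using assms(1) by simp_all
  then have "has_supersolution D \<longleftrightarrow> has_supersolution D'"
    using assms(2,3) has_supersolution_change_traps by blast
  then show ?thesis by (simp add: critical_def non_critical_iff_has_supersolution)
qed

theorem corollary4p6:
  fixes D :: "int set"
  assumes "infinite D"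
  shows "(critical (D \<union> {0}) \<longleftrightarrow> critical (D - {0})) \<and>
         (\<forall>D'. finite (sym_diff D D') \<longrightarrow> (critical D \<longleftrightarrow> critical D'))"
proof (intro conjI allI impI)
  have "finite (sym_diff (D \<union> {0}) (D - {0}))"
    by (rule finite_subset[of _ "{0}"]) auto
  moreover have "D - {0} \<noteq> {}" using assms by (metis finite.emptyI infinite_remove)
  ultimately show "critical (D \<union> {0}) \<longleftrightarrow> critical (D - {0})"
    by (intro critical_cong_finite_sym_diff) auto
next
  fix D' assume fin: "finite (sym_diff D D')"
  \<comment> \<open>An empty \<open>D'\<close> would make the symmetric difference equal to the
    infinite set \<open>D\<close>.\<close>
  have "D \<noteq> {}" "D' \<noteq> {}" using assms fin by auto
  with fin show "critical D \<longleftrightarrow> critical D'" by (intro critical_cong_finite_sym_diff)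
qed

end
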